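(* Let $d\ge2$ be an integer and $0<\delta<1$. Then \[ N_{[]}(d,\delta)\le d+\delta^{-d}\Bigl(1+\sqrt{2d\delta}+\frac{d+5}{6}\delta\Bigr)^d\le d+\delta^{-d}\exp\bigl(d\sqrt{2d\delta}\bigr), \] \[ N(d,\delta)\le\delta^{-d}\Bigl(1+2\sqrt{d\delta}+\frac{d+5}{3}\delta\Bigr)^d\le\delta^{-d}\exp\bigl(2d\sqrt{d\delta}\bigr). \]
   Context: For $\boldsymbol x\in[0,1]^d$ put $V(\boldsymbol x)=\prod_{j=1}^d x_j$; $\boldsymbol x\le\boldsymbol y$ is coordinatewise. If $\boldsymbol x\le\boldsymbol y$ in $[0,1]^d$, the box $[\boldsymbol x,\boldsymbol y]$ is a $\delta$-bracket when $V(\boldsymbol y)-V(\boldsymbol x)\le\delta$. A $\delta$-bracketing cover is a finite family of $\delta$-brackets whose union is $[0,1]^d$; $N_{[]}(d,\delta)$ is its minimum possible cardinality. A finite set $\Gamma\subset[0,1]^d$ is a $\delta$-cover if for every $\boldsymbol z\in[0,1]^d$ there are $\boldsymbol x,\boldsymbol y\in\Gamma\cup\{\boldsymbol 0\}$ with $\boldsymbol x\le\boldsymbol z\le\boldsymbol y$ and $V(\boldsymbol y)-V(\boldsymbol x)\le\delta$; $N(d,\delta)$ is the minimum cardinality $|\Gamma|$ of a $\delta$-cover. *)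

theory Defs
  imports Complex_Main "HOL-Library.FuncSet"
begin

text \<open>
  A point of \<open>[0,1]\<^sup>d\<close> is a function \<open>nat \<Rightarrow> real\<close> with coordinates \<open>x 0, \<dots>, x (d - 1)\<close>,
  equal to \<^term>\<open>undefined\<close> outside \<open>{..<d}\<close>, so that equality of functions, and hence
  \<^term>\<open>card\<close>, is equality of points.
\<close>

definition unit_cube :: "nat \<Rightarrow> (nat \<Rightarrow> real) set" where
  "unit_cube d = ({..<d} \<rightarrow>\<^sub>E {0..1})"

definition origin :: "nat \<Rightarrow> nat \<Rightarrow> real" where
  "origin d = (\<lambda>i\<in>{..<d}. 0)"

definition vol :: "nat \<Rightarrow> (nat \<Rightarrow> real) \<Rightarrow> real" where
  "vol d x = (\<Prod>j<d. x j)"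

definition coord_le :: "nat \<Rightarrow> (nat \<Rightarrow> real) \<Rightarrow> (nat \<Rightarrow> real) \<Rightarrow> bool" where
  "coord_le d x y \<longleftrightarrow> (\<forall>j<d. x j \<le> y j)"

definition cube_box :: "nat \<Rightarrow> (nat \<Rightarrow> real) \<Rightarrow> (nat \<Rightarrow> real) \<Rightarrow> (nat \<Rightarrow> real) set" where
  "cube_box d x y = {z \<in> unit_cube d. coord_le d x z \<and> coord_le d z y}"

definition is_bracket :: "nat \<Rightarrow> real \<Rightarrow> (nat \<Rightarrow> real) set \<Rightarrow> bool" where
  "is_bracket d \<delta> B \<longleftrightarrow>
     (\<exists>x\<in>unit_cube d. \<exists>y\<in>unit_cube d.
        coord_le d x y \<and> B = cube_box d x y \<and> vol d y - vol d x \<le> \<delta>)"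

definition is_bracketing_cover :: "nat \<Rightarrow> real \<Rightarrow> (nat \<Rightarrow> real) set set \<Rightarrow> bool" where
  "is_bracketing_cover d \<delta> F \<longleftrightarrow>
     finite F \<and> (\<forall>B\<in>F. is_bracket d \<delta> B) \<and> \<Union>F = unit_cube d"

definition is_delta_cover :: "nat \<Rightarrow> real \<Rightarrow> (nat \<Rightarrow> real) set \<Rightarrow> bool" where
  "is_delta_cover d \<delta> \<Gamma> \<longleftrightarrow>
     finite \<Gamma> \<and> \<Gamma> \<subseteq> unit_cube d \<and>
     (\<forall>z\<in>unit_cube d. \<exists>x\<in>\<Gamma> \<union> {origin d}. \<exists>y\<in>\<Gamma> \<union> {origin d}.
        coord_le d x z \<and> coord_le d z y \<and> vol d y - vol d x \<le> \<delta>)"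

text \<open>
  The two minima below are attained for every \<open>\<delta> > 0\<close>; see \<open>bracketing_number_attained\<close> and
  \<open>covering_number_attained\<close>.
\<close>

definition bracketing_number :: "nat \<Rightarrow> real \<Rightarrow> nat" where
  "bracketing_number d \<delta> = (LEAST n. \<exists>F. is_bracketing_cover d \<delta> F \<and> card F = n)"

definition covering_number :: "nat \<Rightarrow> real \<Rightarrow> nat" where
  "covering_number d \<delta> = (LEAST n. \<exists>\<Gamma>. is_delta_cover d \<delta> \<Gamma> \<and> card \<Gamma> = n)"

lemma ex_delta_cover:
  assumes "\<delta> > 0"
  shows "\<exists>\<Gamma>. is_delta_cover d \<delta> \<Gamma>"
proof -
  obtain m0 :: nat where m0: "real d / \<delta> < real m0"
    using reals_Archimedean2 by blast
  define m where "m = Suc m0"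
  have m: "m > 0" "real d / real m \<le> \<delta>"
    using m0 assms by (auto simp: m_def field_simps)
  define G :: "(nat \<Rightarrow> real) set" where
    "G = ({..<d} \<rightarrow>\<^sub>E (\<lambda>k. real k / real m) ` {..m})"
  have "finite G" unfolding G_def by (intro finite_PiE) auto
  moreover have "G \<subseteq> unit_cube d"
    unfolding G_def unit_cube_def by (intro PiE_mono) (use m in auto)
  moreover have "\<exists>x\<in>G. \<exists>y\<in>G. coord_le d x z \<and> coord_le d z y \<and> vol d y - vol d x \<le> \<delta>"
    if z: "z \<in> unit_cube d" for z
  proof -
    have z01: "0 \<le> z j" "z j \<le> 1" if "j < d" for j
      using z that by (auto simp: unit_cube_def PiE_iff)
    define x where "x = (\<lambda>j\<in>{..<d}. real (nat \<lfloor>real m * z j\<rfloor>) / real m)"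
    define y where "y = (\<lambda>j\<in>{..<d}. real (nat \<lceil>real m * z j\<rceil>) / real m)"
    have fl: "nat \<lfloor>real m * z j\<rfloor> \<le> m" and cl: "nat \<lceil>real m * z j\<rceil> \<le> m"
      and xz: "x j \<le> z j" and zy: "z j \<le> y j" and yx: "y j - x j \<le> 1 / real m"
      if "j < d" for j
    proof -
      have a: "0 \<le> real m * z j" "real m * z j \<le> real m"
        using z01[OF that] m by (auto simp: mult_le_cancel_left1)
      show "nat \<lfloor>real m * z j\<rfloor> \<le> m" "nat \<lceil>real m * z j\<rceil> \<le> m" using a by linarith+
      have f: "real (nat \<lfloor>real m * z j\<rfloor>) \<le> real m * z j"
        and c: "real m * z j \<le> real (nat \<lceil>real m * z j\<rceil>)"
        using a by linarith+
      have "nat \<lceil>real m * z j\<rceil> \<le> Suc (nat \<lfloor>real m * z j\<rfloor>)"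
        using ceiling_diff_floor_le_1[of "real m * z j"] by linarith
      then have cf: "real (nat \<lceil>real m * z j\<rceil>) - real (nat \<lfloor>real m * z j\<rfloor>) \<le> 1"
        by linarith
      show "x j \<le> z j" "z j \<le> y j"
        using f c m that by (auto simp: x_def y_def field_simps)
      show "y j - x j \<le> 1 / real m"
        using divide_right_mono[OF cf, of "real m"] m that
        by (simp add: x_def y_def diff_divide_distrib)
    qed
    have xG: "x \<in> G" and yG: "y \<in> G"
      using fl cl by (auto simp: G_def x_def y_def)
    have b: "norm (x j) \<le> 1" "norm (y j) \<le> 1" if "j < d" for j
      using fl[OF that] cl[OF that] m that by (auto simp: x_def y_def)
    have "vol d y - vol d x \<le> norm (prod y {..<d} - prod x {..<d})"
      by (simp add: vol_def)
    also have "\<dots> \<le> (\<Sum>j<d. norm (y j - x j))"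
      by (rule norm_prod_diff) (use b in auto)
    also have "\<dots> \<le> (\<Sum>j<d. 1 / real m)"
      using xz zy yx by (intro sum_mono) fastforce
    also have "\<dots> \<le> \<delta>" using m by simp
    finally show ?thesis
      using xG yG xz zy by (auto simp: coord_le_def)
  qed
  ultimately have "is_delta_cover d \<delta> G"
    unfolding is_delta_cover_def by blast
  then show ?thesis ..
qed

lemma ex_bracketing_cover:
  assumes "\<delta> > 0"
  shows "\<exists>F. is_bracketing_cover d \<delta> F"
proof -
  obtain \<Gamma> where \<Gamma>: "is_delta_cover d \<delta> \<Gamma>"
    using ex_delta_cover[OF assms] by blast
  define H where "H = \<Gamma> \<union> {origin d}"
  have H: "finite H" "H \<subseteq> unit_cube d"
    using \<Gamma> by (auto simp: H_def is_delta_cover_def origin_def unit_cube_def)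
  define P where "P = {p \<in> H \<times> H. coord_le d (fst p) (snd p) \<and> vol d (snd p) - vol d (fst p) \<le> \<delta>}"
  define F where "F = (\<lambda>p. cube_box d (fst p) (snd p)) ` P"
  have "finite P" using H by (auto simp: P_def)
  then have "finite F" by (simp add: F_def)
  moreover have "is_bracket d \<delta> B" if "B \<in> F" for B
    using that H(2) unfolding F_def P_def is_bracket_def by fastforce
  moreover have "\<Union>F = unit_cube d"
  proof
    show "\<Union>F \<subseteq> unit_cube d" by (auto simp: F_def cube_box_def)
    show "unit_cube d \<subseteq> \<Union>F"
    proof
      fix z assume z: "z \<in> unit_cube d"
      then obtain x y where xy: "x \<in> H" "y \<in> H" "coord_le d x z" "coord_le d z y"
        "vol d y - vol d x \<le> \<delta>"
        using \<Gamma> unfolding is_delta_cover_def H_def by blast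
      have "coord_le d x y" using xy by (force simp: coord_le_def)
      then have "(x, y) \<in> P" using xy by (simp add: P_def)
      moreover have "z \<in> cube_box d x y" using xy z by (simp add: cube_box_def)
      ultimately show "z \<in> \<Union>F" by (force simp: F_def)
    qed
  qed
  ultimately show ?thesis unfolding is_bracketing_cover_def by blast
qed

lemma bracketing_number_attained:
  assumes "\<delta> > 0"
  shows "\<exists>F. is_bracketing_cover d \<delta> F \<and> card F = bracketing_number d \<delta>"
  unfolding bracketing_number_def by (rule LeastI_ex) (use ex_bracketing_cover[OF assms] in blast)

lemma covering_number_attained:
  assumes "\<delta> > 0"
  shows "\<exists>\<Gamma>. is_delta_cover d \<delta> \<Gamma> \<and> card \<Gamma> = covering_number d \<delta>"
  unfolding covering_number_def by (rule LeastI_ex) (use ex_delta_cover[OF assms] in blast)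

end

theory Submission
  imports Defs "HOL-Analysis.Convex"
begin

text \<open>
  Cut the cube into \<open>Q ^ d\<close> equal blocks, and let \<open>b = (b\<^sub>0, b\<^sub>1, \<dots>)\<close> be the upper corner of one of
  them. On \<open>x \<le> b\<close> the partial derivative of the volume \<open>V\<close> in direction \<open>i\<close> is at most
  \<open>p\<^sub>i = (\<Prod>j\<noteq>i. b\<^sub>j)\<close>. So the block may be cut, in direction \<open>i\<close>, into
  \<open>n\<^sub>i = \<lceil>c p\<^sub>i\<rceil>\<close> parts with \<open>c = d / (\<delta> Q)\<close>: each direction contributes at most \<open>\<delta> / d\<close> to the
  increment of \<open>V\<close> across a cell, and every cell is a \<open>\<delta>\<close>-bracket.
  Up to rounding, the block has \<open>c ^ d * V b ^ (d - 1)\<close> cells. So the blocks of small volume get few of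
  them, and since \<open>V ^ (d - 1)\<close> has the integral \<open>1 / d ^ d\<close> over the cube, the total is close to
  \<open>1 / \<delta> ^ d\<close>.

  More precisely, the number of cells is at most the sum over all blocks of \<open>\<Prod>i. 1 + c p\<^sub>i\<close>. The factors
  depend on all coordinates of the block, but the geometric mean is superadditive
  (\<open>add_prod_power_le_prod_add_power\<close>), and this bounds the product by \<open>\<Prod>i. 1 + c b\<^sub>i ^ (d - 1)\<close>
  (\<open>prod_add_prod_others_le\<close>), in which the coordinates are separated. The sum over the blocks is
  then the \<open>d\<close>-th power of \<open>Q + c * (\<Sum>k=1..Q. (k / Q) ^ (d - 1))\<close>. An upper Riemann sum of
  \<open>x ^ (d - 1)\<close> appears, whose excess over \<open>1 / d\<close> is controlled by the first Euler-Maclaurin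
  corrections (\<open>sum_power_le_faulhaber\<close>). The result is \<open>1 / \<delta>\<close> times
  \<open>1 + d / (2 * Q) + d * (d - 1) / (12 * Q\<^sup>2) + Q * \<delta>\<close>,
  where the second term is the price of large blocks and the last one the price of rounding \<open>n\<^sub>i\<close>
  up. They balance at \<open>Q\<close> close to \<open>sqrt (d / (2 * \<delta>))\<close> (\<open>ex_balanced_block_count\<close>).

  For a \<open>\<delta>\<close>-cover one takes all vertices of the cells. A block has \<open>n\<^sub>i + 1\<close> of them
  in direction \<open>i\<close>, so the summand \<open>1\<close> becomes \<open>2\<close> and the last term becomes \<open>2 Q \<delta>\<close>; the
  balanced value follows from the previous one by replacing \<open>\<delta>\<close> with \<open>2 \<delta>\<close> inside the bracket only.
  The exponential bounds come from \<open>1 + w + w\<^sup>2 / 2 \<le> exp w\<close>.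
\<close>

section \<open>Superadditivity of the geometric mean\<close>

text \<open>
  Minkowski's inequality for geometric means. Dividing both sequences by their pointwise sum
  reduces it to the arithmetic-geometric mean inequality, applied once to the sequence with
  constant value \<open>a\<close> and once to the one with values \<open>c * b j ^ card J\<close>: the two arithmetic means of
  the quotients add up to one.
\<close>

lemma add_prod_power_le_prod_add_power:
  fixes a c :: real
  assumes J: "finite J" "J \<noteq> {}" and a: "a > 0" and c: "c > 0" and b: "\<And>j. j \<in> J \<Longrightarrow> b j > 0"
  shows "(a + c * (\<Prod>j\<in>J. b j)) ^ card J \<le> (\<Prod>j\<in>J. a + c * b j ^ card J)"
proof -
  define m where "m = card J"
  define x where "x j = a + c * b j ^ m" for j
  define M where "M = (\<Prod>j\<in>J. x j) powr (1 / m)"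
  have m: "m > 0" using J by (simp add: m_def card_gt_0_iff)
  have x: "x j > 0" if "j \<in> J" for j
    using a c b[OF that] by (simp add: x_def add_pos_pos)
  have X: "(\<Prod>j\<in>J. x j) > 0" by (rule prod_pos) (rule x)
  have B: "(\<Prod>j\<in>J. b j) > 0" by (rule prod_pos) (rule b)
  have M: "M > 0" using X unfolding M_def by simp
  have pw: "(t ^ m) powr (1 / m) = t" if "t > 0" for t :: real
    using m that by (simp add: powr_realpow[symmetric] powr_powr)
  have "(\<Prod>j\<in>J. a / x j) = a ^ m / (\<Prod>j\<in>J. x j)"
    by (simp add: prod_dividef m_def)
  then have "(\<Prod>j\<in>J. a / x j) powr (1 / m) = a / M"
    using a X by (simp add: powr_divide pw M_def)
  then have 1: "a / M \<le> (\<Sum>j\<in>J. a / x j / m)"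
    using arith_geom_mean[OF J, of "\<lambda>j. a / x j"] a x by (simp add: m_def less_imp_le)
  have "(\<Prod>j\<in>J. c * b j ^ m / x j) = (c * (\<Prod>j\<in>J. b j)) ^ m / (\<Prod>j\<in>J. x j)"
    by (simp add: prod_dividef m_def prod.distrib power_mult_distrib prod_power_distrib)
  then have "(\<Prod>j\<in>J. c * b j ^ m / x j) powr (1 / m) = c * (\<Prod>j\<in>J. b j) / M"
    using c B X by (simp add: powr_divide pw M_def)
  then have 2: "c * (\<Prod>j\<in>J. b j) / M \<le> (\<Sum>j\<in>J. c * b j ^ m / x j / m)"
    using arith_geom_mean[OF J, of "\<lambda>j. c * b j ^ m / x j"] c b x by (simp add: m_def less_imp_le)
  have "(a + c * (\<Prod>j\<in>J. b j)) / M \<le> (\<Sum>j\<in>J. a / x j / m + c * b j ^ m / x j / m)"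
    using 1 2 by (simp add: add_divide_distrib sum.distrib)
  also have "\<dots> = (\<Sum>j\<in>J. 1 / m)"
  proof (rule sum.cong)
    fix j assume "j \<in> J"
    have "a / x j / m + c * b j ^ m / x j / m = x j / x j / m"
      unfolding add_divide_distrib[symmetric] by (simp add: x_def)
    then show "a / x j / m + c * b j ^ m / x j / m = 1 / m" using x[OF \<open>j \<in> J\<close>] by simp
  qed simp
  also have "\<dots> = 1" using m by (simp add: m_def)
  finally have "a + c * (\<Prod>j\<in>J. b j) \<le> M" using M by simp
  then have "(a + c * (\<Prod>j\<in>J. b j)) ^ m \<le> M ^ m"
    using a c B by (intro power_mono) auto
  also have "M ^ m = (\<Prod>j\<in>J. x j)"
    using M X m by (simp add: M_def powr_realpow[symmetric] powr_powr)
  finally show ?thesis by (simp add: m_def x_def)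
qed

text \<open>
  This is what separates the coordinates. Raised to the power \<open>card I - 1\<close>, each factor on the
  left is bounded by Minkowski's inequality over \<open>I - {i}\<close>, and in the product of these bounds
  every index of \<open>I\<close> occurs \<open>card I - 1\<close> times.
\<close>

lemma prod_add_prod_others_le:
  fixes a c :: real
  assumes I: "finite I" "card I \<ge> 2" and a: "a > 0" and c: "c > 0" and b: "\<And>j. j \<in> I \<Longrightarrow> b j > 0"
  shows "(\<Prod>i\<in>I. a + c * (\<Prod>j\<in>I - {i}. b j)) \<le> (\<Prod>i\<in>I. a + c * b i ^ (card I - 1))"
proof -
  define m where "m = card I - 1"
  have m: "m > 0" using I by (simp add: m_def)
  have card: "card (I - {i}) = m" if "i \<in> I" for i
    using that I by (simp add: m_def)
  have pos: "a + c * b j ^ m > 0" if "j \<in> I" for j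
    using a c b[OF that] by (simp add: add_pos_pos)
  have pos': "a + c * (\<Prod>j\<in>I - {i}. b j) > 0" for i
    using a c b by (intro add_pos_pos mult_pos_pos prod_pos) auto
  have "(\<Prod>i\<in>I. a + c * (\<Prod>j\<in>I - {i}. b j)) ^ m
      = (\<Prod>i\<in>I. (a + c * (\<Prod>j\<in>I - {i}. b j)) ^ m)"
    by (simp add: prod_power_distrib)
  also have "\<dots> \<le> (\<Prod>i\<in>I. \<Prod>j\<in>I - {i}. a + c * b j ^ m)"
  proof (rule prod_mono)
    fix i assume i: "i \<in> I"
    have "I - {i} \<noteq> {}" using card[OF i] m by (metis card.empty less_numeral_extra(3))
    then have "(a + c * (\<Prod>j\<in>I - {i}. b j)) ^ m \<le> (\<Prod>j\<in>I - {i}. a + c * b j ^ m)"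
      using add_prod_power_le_prod_add_power[of "I - {i}" a c b] I a c b card[OF i] by auto
    then show "0 \<le> (a + c * (\<Prod>j\<in>I - {i}. b j)) ^ m \<and>
        (a + c * (\<Prod>j\<in>I - {i}. b j)) ^ m \<le> (\<Prod>j\<in>I - {i}. a + c * b j ^ m)"
      using pos'[of i] by simp
  qed
  also have "\<dots> = (\<Prod>j\<in>I. a + c * b j ^ m) ^ m"
  proof -
    define P where "P = (\<Prod>j\<in>I. a + c * b j ^ m)"
    have P: "P > 0" unfolding P_def by (rule prod_pos) (rule pos)
    have "(\<Prod>j\<in>I - {i}. a + c * b j ^ m) = P / (a + c * b i ^ m)" if "i \<in> I" for i
      using prod.remove[OF I(1) that, of "\<lambda>j. a + c * b j ^ m"] pos[OF that]
      by (simp add: P_def field_simps)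
    then have "(\<Prod>i\<in>I. \<Prod>j\<in>I - {i}. a + c * b j ^ m) = (\<Prod>i\<in>I. P / (a + c * b i ^ m))"
      by (intro prod.cong) auto
    also have "\<dots> = P ^ Suc m / P"
      using I by (simp add: prod_dividef P_def m_def)
    also have "\<dots> = P ^ m" using P by simp
    finally show ?thesis by (simp add: P_def)
  qed
  finally have "(\<Prod>i\<in>I. a + c * (\<Prod>j\<in>I - {i}. b j)) ^ m \<le> (\<Prod>j\<in>I. a + c * b j ^ m) ^ m" .
  then show ?thesis
    using m pos unfolding m_def[symmetric]
    by (subst (asm) power_mono_iff) (auto intro!: prod_nonneg less_imp_le[OF pos'] less_imp_le[OF pos])
qed

section \<open>A Faulhaber inequality\<close>

text \<open>
  The first three terms of the Euler-Maclaurin expansion of the sum of the powers \<open>k ^ (q + 1)\<close> up to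
  \<open>x\<close>; for \<open>q = 0\<close> the last one is only a constant, harmless in increments. Shifting the exponent by
  one avoids truncated subtraction.
\<close>

definition faulhaber :: "nat \<Rightarrow> real \<Rightarrow> real" where
  "faulhaber q x = x ^ (q + 2) / (q + 2) + x ^ (q + 1) / 2 + (q + 1) * x ^ q / 12"

lemma DERIV_faulhaber:
  "(faulhaber (Suc q) has_real_derivative (real q + 2) * faulhaber q x) (at x)"
  unfolding faulhaber_def
  by (rule derivative_eq_intros refl | simp)+ (simp add: field_simps)

text \<open>
  Equality holds for \<open>q = 0\<close>. Both sides reproduce themselves under differentiation, up to the factor
  \<open>q + 2\<close>, so that the inequality for \<open>q\<close> says that the difference of the two sides for \<open>q + 1\<close> is
  nondecreasing, and it remains to look at \<open>x = 0\<close>.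
\<close>

lemma faulhaber_increment:
  assumes "x \<ge> 0"
  shows "(x + 1) ^ (q + 1) \<le> faulhaber q (x + 1) - faulhaber q x"
  using assms
proof (induction q arbitrary: x)
  case 0
  show ?case by (simp add: faulhaber_def power2_eq_square field_simps)
next
  case (Suc q)
  define g where "g y = faulhaber (Suc q) (y + 1) - faulhaber (Suc q) y - (y + 1) ^ (q + 2)" for y
  have D: "(g has_real_derivative
      (real q + 2) * (faulhaber q (y + 1) - faulhaber q y - (y + 1) ^ (q + 1))) (at y)" for y
  proof -
    have 1: "((\<lambda>y. faulhaber (Suc q) (y + 1)) has_real_derivative
        (real q + 2) * faulhaber q (y + 1)) (at y)"
      using DERIV_faulhaber[of q "y + 1"] unfolding DERIV_shift .
    have 2: "((\<lambda>y. (y + 1) ^ (q + 2)) has_real_derivative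
        (real q + 2) * (y + 1) ^ (q + 1)) (at y)"
      by (rule derivative_eq_intros refl | simp)+
    show ?thesis
      unfolding g_def right_diff_distrib by (intro DERIV_diff 1 2 DERIV_faulhaber)
  qed
  have "0 \<le> g 0"
  proof -
    have "g 0 = 1 / (q + 3) + 1 / 2 + (q + 2) / 12 - 1"
      by (simp add: g_def faulhaber_def)
    also have "\<dots> = q * (real q - 1) / (12 * (q + 3))"
      by (simp add: field_simps)
    \<comment> \<open>Only for integers: the value is negative for real \<open>q\<close> between \<open>0\<close> and \<open>1\<close>.\<close>
    also have "\<dots> \<ge> 0" by (cases q) auto
    finally show ?thesis .
  qed
  also have "g 0 \<le> g x"
  proof (rule DERIV_nonneg_imp_nondecreasing[OF Suc.prems])
    fix y :: real assume "0 \<le> y"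
    then have "0 \<le> (real q + 2) * (faulhaber q (y + 1) - faulhaber q y - (y + 1) ^ (q + 1))"
      using Suc.IH[of y] by simp
    then show "\<exists>z. DERIV g y :> z \<and> z \<ge> 0" using D by blast
  qed
  finally show ?case by (simp add: g_def)
qed

lemma sum_power_le_faulhaber: "(\<Sum>k<n. (real k + 1) ^ (q + 1)) \<le> faulhaber q n"
proof (induction n)
  case 0
  show ?case by (simp add: faulhaber_def)
next
  case (Suc n)
  then show ?case using faulhaber_increment[of "real n" q] by (simp add: add.commute)
qed

section \<open>Grids adapted to the volume\<close>

text \<open>
  The discrete form of bounding the increment of a product by its partial derivatives at the upper
  end point.
\<close>

lemma prod_diff_le_sum:
  fixes x y :: "'a \<Rightarrow> real"
  assumes "finite I" and "\<And>i. i \<in> I \<Longrightarrow> 0 \<le> x i \<and> x i \<le> y i"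
  shows "prod y I - prod x I \<le> (\<Sum>i\<in>I. (y i - x i) * (\<Prod>j\<in>I - {i}. y j))"
  using assms
proof (induction I rule: finite_induct)
  case (insert a I)
  have le: "prod x I \<le> prod y I" using insert by (intro prod_mono) auto
  have "prod y (insert a I) - prod x (insert a I) = (y a - x a) * prod y I + x a * (prod y I - prod x I)"
    using insert by (simp add: algebra_simps)
  also have "\<dots> \<le> (y a - x a) * prod y I + y a * (prod y I - prod x I)"
    using insert.prems[of a] le by (intro add_left_mono mult_right_mono) auto
  also have "\<dots> \<le> (y a - x a) * prod y I + y a * (\<Sum>i\<in>I. (y i - x i) * (\<Prod>j\<in>I - {i}. y j))"
    using insert.IH insert.prems by (intro add_left_mono mult_left_mono) force+
  also have "y a * (\<Sum>i\<in>I. (y i - x i) * (\<Prod>j\<in>I - {i}. y j))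
      = (\<Sum>i\<in>I. (y i - x i) * (\<Prod>j\<in>insert a I - {i}. y j))"
    unfolding sum_distrib_left
  proof (rule sum.cong)
    fix i assume i: "i \<in> I"
    then have "insert a I - {i} = insert a (I - {i})" using insert by auto
    then show "y a * ((y i - x i) * (\<Prod>j\<in>I - {i}. y j)) = (y i - x i) * (\<Prod>j\<in>insert a I - {i}. y j)"
      using insert by simp
  qed simp
  also have "(y a - x a) * prod y I + \<dots> = (\<Sum>i\<in>insert a I. (y i - x i) * (\<Prod>j\<in>insert a I - {i}. y j))"
    using insert by simp
  finally show ?case .
qed simp

lemma ex_unit_interval_containing:
  fixes t :: real
  assumes "0 \<le> t" "t \<le> real n" "n > 0"
  shows "\<exists>k<n. real k \<le> t \<and> t \<le> real k + 1"
proof (cases "t = n")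
  case True
  then show ?thesis using assms by (intro exI[of _ "n - 1"]) (auto simp: of_nat_diff)
next
  case False
  then have "nat \<lfloor>t\<rfloor> < n" using assms by linarith
  moreover have "real (nat \<lfloor>t\<rfloor>) \<le> t" "t \<le> real (nat \<lfloor>t\<rfloor>) + 1" using assms by linarith+
  ultimately show ?thesis by blast
qed

text \<open>
  Blocks are indexed from \<open>0\<close>, so that block \<open>k\<close> has the upper corner with coordinates \<open>(k j + 1) / Q\<close>.
  The following product is the partial derivative of the volume in direction \<open>i\<close> at that corner.
\<close>

definition others :: "nat \<Rightarrow> nat \<Rightarrow> (nat \<Rightarrow> nat) \<Rightarrow> nat \<Rightarrow> real" where
  "others d Q k i = (\<Prod>j\<in>{..<d} - {i}. (real (k j) + 1) / Q)"

definition subdivisions :: "nat \<Rightarrow> real \<Rightarrow> nat \<Rightarrow> (nat \<Rightarrow> nat) \<Rightarrow> nat \<Rightarrow> nat" where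
  "subdivisions d \<delta> Q k i = nat \<lceil>d / (\<delta> * Q) * others d Q k i\<rceil>"

definition grid_point ::
    "nat \<Rightarrow> real \<Rightarrow> nat \<Rightarrow> (nat \<Rightarrow> nat) \<Rightarrow> (nat \<Rightarrow> nat) \<Rightarrow> nat \<Rightarrow> real" where
  "grid_point d \<delta> Q k m = (\<lambda>i\<in>{..<d}. (k i + m i / subdivisions d \<delta> Q k i) / Q)"

abbreviation blocks :: "nat \<Rightarrow> nat \<Rightarrow> (nat \<Rightarrow> nat) set" where
  "blocks d Q \<equiv> {..<d} \<rightarrow>\<^sub>E {..<Q}"

text \<open>
  A cell is recorded by its block and by the index of its lower corner inside the block.
  In \<open>nodes\<close> the last index of each direction is included: the grids of neighbouring blocks need
  not match on the common face, so each block has to bring all the vertices of its cells.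
\<close>

definition cells :: "nat \<Rightarrow> real \<Rightarrow> nat \<Rightarrow> ((nat \<Rightarrow> nat) \<times> (nat \<Rightarrow> nat)) set" where
  "cells d \<delta> Q = (SIGMA k:blocks d Q. PiE {..<d} (\<lambda>i. {..<subdivisions d \<delta> Q k i}))"

definition nodes :: "nat \<Rightarrow> real \<Rightarrow> nat \<Rightarrow> ((nat \<Rightarrow> nat) \<times> (nat \<Rightarrow> nat)) set" where
  "nodes d \<delta> Q = (SIGMA k:blocks d Q. PiE {..<d} (\<lambda>i. {..subdivisions d \<delta> Q k i}))"

definition upper_corner :: "nat \<Rightarrow> (nat \<Rightarrow> nat) \<Rightarrow> nat \<Rightarrow> nat" where
  "upper_corner d m = (\<lambda>i\<in>{..<d}. Suc (m i))"

lemma others_pos: "Q > 0 \<Longrightarrow> others d Q k i > 0"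
  by (auto simp: others_def intro!: prod_pos)

lemma subdivisions_bounds:
  assumes "d > 0" "\<delta> > 0" "Q > 0"
  shows "subdivisions d \<delta> Q k i > 0"
    and "d / (\<delta> * Q) * others d Q k i \<le> subdivisions d \<delta> Q k i"
    and "subdivisions d \<delta> Q k i \<le> 1 + d / (\<delta> * Q) * others d Q k i"
proof -
  have "d / (\<delta> * Q) * others d Q k i > 0"
    using assms others_pos[of Q d k i] by simp
  then show "subdivisions d \<delta> Q k i > 0"
    and "d / (\<delta> * Q) * others d Q k i \<le> subdivisions d \<delta> Q k i"
    and "subdivisions d \<delta> Q k i \<le> 1 + d / (\<delta> * Q) * others d Q k i"
    unfolding subdivisions_def by linarith+
qed

lemma cell_corners_in_nodes:
  assumes "(k, m) \<in> cells d \<delta> Q"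
  shows "(k, m) \<in> nodes d \<delta> Q" "(k, upper_corner d m) \<in> nodes d \<delta> Q"
  using assms by (auto simp: cells_def nodes_def upper_corner_def PiE_iff Suc_le_eq less_imp_le)

lemma grid_point_bounds:
  assumes "d > 0" "\<delta> > 0" "Q > 0" and km: "(k, m) \<in> nodes d \<delta> Q" and i: "i < d"
  shows "0 \<le> grid_point d \<delta> Q k m i" "grid_point d \<delta> Q k m i \<le> (real (k i) + 1) / Q"
    "(real (k i) + 1) / Q \<le> 1"
proof -
  have "m i / subdivisions d \<delta> Q k i \<le> 1"
    using km i subdivisions_bounds(1)[OF assms(1-3), of k i] by (auto simp: nodes_def PiE_iff)
  then show "0 \<le> grid_point d \<delta> Q k m i" "grid_point d \<delta> Q k m i \<le> (real (k i) + 1) / Q"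
    using assms(3) i by (auto simp: grid_point_def divide_right_mono)
  have "k i + 1 \<le> Q" using km i by (force simp: nodes_def PiE_iff)
  then have "real (k i) + 1 \<le> Q" by linarith
  then show "(real (k i) + 1) / Q \<le> 1" using assms(3) by simp
qed

lemma grid_point_in_unit_cube:
  assumes "d > 0" "\<delta> > 0" "Q > 0" "(k, m) \<in> nodes d \<delta> Q"
  shows "grid_point d \<delta> Q k m \<in> unit_cube d"
proof -
  have "grid_point d \<delta> Q k m i \<in> {0..1}" if "i < d" for i
    using grid_point_bounds[OF assms that] by auto
  then show ?thesis by (auto simp: unit_cube_def PiE_iff grid_point_def)
qed

lemma grid_point_upper:
  assumes "d > 0" "\<delta> > 0" "Q > 0" and i: "i < d"
  shows "grid_point d \<delta> Q k (upper_corner d m) i - grid_point d \<delta> Q k m i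
    = 1 / (Q * subdivisions d \<delta> Q k i)"
  using assms subdivisions_bounds(1)[OF assms(1-3), of k i]
  by (simp add: grid_point_def upper_corner_def field_simps)

text \<open>
  The number of subdivisions is chosen so that each direction contributes at most \<open>\<delta> / d\<close>.
\<close>

lemma cell_vol_diff_le:
  assumes "d > 0" "\<delta> > 0" "Q > 0" and km: "(k, m) \<in> cells d \<delta> Q"
  shows "vol d (grid_point d \<delta> Q k (upper_corner d m)) - vol d (grid_point d \<delta> Q k m) \<le> \<delta>"
proof -
  define x where "x = grid_point d \<delta> Q k m"
  define y where "y = grid_point d \<delta> Q k (upper_corner d m)"
  note nodes = cell_corners_in_nodes[OF km]
  have yx: "y i - x i = 1 / (Q * subdivisions d \<delta> Q k i)" if "i < d" for i
    using grid_point_upper[OF assms(1-3) that] by (simp add: x_def y_def)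
  have "vol d y - vol d x \<le> (\<Sum>i<d. (y i - x i) * (\<Prod>j\<in>{..<d} - {i}. y j))"
    unfolding vol_def
  proof (rule prod_diff_le_sum)
    fix i assume "i \<in> {..<d}"
    then have i: "i < d" by simp
    have "y i - x i \<ge> 0" unfolding yx[OF i] by simp
    then show "0 \<le> x i \<and> x i \<le> y i"
      using grid_point_bounds(1)[OF assms(1-3) nodes(1) i] by (simp add: x_def)
  qed simp
  also have "\<dots> \<le> (\<Sum>i<d. \<delta> / d)"
  proof (rule sum_mono)
    fix i assume "i \<in> {..<d}"
    then have i: "i < d" by simp
    define n where "n = subdivisions d \<delta> Q k i"
    have n: "n > 0" "d / (\<delta> * Q) * others d Q k i \<le> n"
      using subdivisions_bounds[OF assms(1-3)] by (auto simp: n_def)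
    have "(\<Prod>j\<in>{..<d} - {i}. y j) \<le> others d Q k i"
      unfolding others_def y_def
      using grid_point_bounds[OF assms(1-3) nodes(2)] by (intro prod_mono) auto
    then have "(y i - x i) * (\<Prod>j\<in>{..<d} - {i}. y j) \<le> (y i - x i) * others d Q k i"
      unfolding yx[OF i] by (rule mult_left_mono) simp
    also have "\<dots> \<le> \<delta> / d"
      unfolding yx[OF i] n_def[symmetric] using n assms by (simp add: field_simps)
    finally show "(y i - x i) * (\<Prod>j\<in>{..<d} - {i}. y j) \<le> \<delta> / d" .
  qed
  also have "\<dots> = \<delta>" using assms by simp
  finally show ?thesis by (simp add: x_def y_def)
qed

lemma cells_cover:
  assumes "d > 0" "\<delta> > 0" "Q > 0" and z: "z \<in> unit_cube d"
  shows "\<exists>(k, m)\<in>cells d \<delta> Q. coord_le d (grid_point d \<delta> Q k m) z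
    \<and> coord_le d z (grid_point d \<delta> Q k (upper_corner d m))"
proof -
  have "\<exists>k<Q. real k \<le> Q * z i \<and> Q * z i \<le> real k + 1" if "i < d" for i
  proof (rule ex_unit_interval_containing)
    have "0 \<le> z i" "z i \<le> 1" using z that by (auto simp: unit_cube_def PiE_iff)
    then show "0 \<le> Q * z i" "Q * z i \<le> Q" by (auto simp: mult_left_le)
  qed (use assms in auto)
  then obtain k0 where k0: "\<And>i. i < d \<Longrightarrow> k0 i < Q \<and> real (k0 i) \<le> Q * z i \<and> Q * z i \<le> real (k0 i) + 1"
    by metis
  define k where "k = (\<lambda>i\<in>{..<d}. k0 i)"
  have k: "k \<in> blocks d Q" using k0 by (simp add: k_def)
  define n where "n i = subdivisions d \<delta> Q k i" for i
  have n: "n i > 0" for i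
    using subdivisions_bounds(1)[OF assms(1-3)] by (simp add: n_def)
  \<comment> \<open>Rescaling the block to the unit cube reduces the choice of \<open>m\<close> to that of \<open>k\<close>.\<close>
  have "\<exists>m<n i. real m \<le> n i * (Q * z i - k i) \<and> n i * (Q * z i - k i) \<le> real m + 1" if "i < d" for i
  proof (rule ex_unit_interval_containing)
    have "0 \<le> Q * z i - k i" "Q * z i - k i \<le> 1" using k0[OF that] that by (auto simp: k_def)
    then show "0 \<le> n i * (Q * z i - k i)" "n i * (Q * z i - k i) \<le> n i" by (auto simp: mult_left_le)
  qed (use n in auto)
  then obtain m0 where m0: "\<And>i. i < d \<Longrightarrow>
      m0 i < n i \<and> real (m0 i) \<le> n i * (Q * z i - k i) \<and> n i * (Q * z i - k i) \<le> real (m0 i) + 1"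
    by metis
  define m where "m = (\<lambda>i\<in>{..<d}. m0 i)"
  have "(k, m) \<in> cells d \<delta> Q" using k m0 by (simp add: cells_def m_def n_def)
  moreover have "grid_point d \<delta> Q k m i \<le> z i \<and> z i \<le> grid_point d \<delta> Q k (upper_corner d m) i"
    if i: "i < d" for i
    using m0[OF i] n[of i] assms(3) i unfolding grid_point_def n_def[symmetric]
    by (auto simp: m_def upper_corner_def field_simps)
  ultimately show ?thesis unfolding coord_le_def by blast
qed

lemma bracketing_number_le_card_cells:
  assumes "d > 0" "\<delta> > 0" "Q > 0"
  shows "bracketing_number d \<delta> \<le> card (cells d \<delta> Q)"
proof -
  define box where "box = (\<lambda>(k, m). cube_box d (grid_point d \<delta> Q k m) (grid_point d \<delta> Q k (upper_corner d m)))"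
  have fin: "finite (cells d \<delta> Q)" by (auto simp: cells_def intro!: finite_PiE)
  have "is_bracket d \<delta> (box c)" if c: "c \<in> cells d \<delta> Q" for c
  proof -
    obtain k m where km: "c = (k, m)" by fastforce
    note nodes = cell_corners_in_nodes[OF c[unfolded km]]
    have "coord_le d (grid_point d \<delta> Q k m) (grid_point d \<delta> Q k (upper_corner d m))"
      unfolding coord_le_def
    proof (intro allI impI)
      fix i assume i: "i < d"
      have "0 \<le> 1 / real (Q * subdivisions d \<delta> Q k i)" by simp
      then show "grid_point d \<delta> Q k m i \<le> grid_point d \<delta> Q k (upper_corner d m) i"
        using grid_point_upper[OF assms i, of k m] by linarith
    qed
    then show ?thesis
      using grid_point_in_unit_cube[OF assms nodes(1)] grid_point_in_unit_cube[OF assms nodes(2)]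
        cell_vol_diff_le[OF assms c[unfolded km]]
      unfolding is_bracket_def box_def km by auto
  qed
  moreover have "\<Union>(box ` cells d \<delta> Q) = unit_cube d"
  proof
    show "\<Union>(box ` cells d \<delta> Q) \<subseteq> unit_cube d" by (auto simp: box_def cube_box_def)
    show "unit_cube d \<subseteq> \<Union>(box ` cells d \<delta> Q)"
      using cells_cover[OF assms] by (fastforce simp: box_def cube_box_def)
  qed
  ultimately have "is_bracketing_cover d \<delta> (box ` cells d \<delta> Q)"
    using fin by (auto simp: is_bracketing_cover_def)
  then have "bracketing_number d \<delta> \<le> card (box ` cells d \<delta> Q)"
    unfolding bracketing_number_def by (intro Least_le) blast
  also have "\<dots> \<le> card (cells d \<delta> Q)" using fin by (rule card_image_le)
  finally show ?thesis .
qed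

lemma covering_number_le_card_nodes:
  assumes "d > 0" "\<delta> > 0" "Q > 0"
  shows "covering_number d \<delta> \<le> card (nodes d \<delta> Q)"
proof -
  define pt where "pt = (\<lambda>(k, m). grid_point d \<delta> Q k m)"
  have fin: "finite (nodes d \<delta> Q)" by (auto simp: nodes_def intro!: finite_PiE)
  have "pt ` nodes d \<delta> Q \<subseteq> unit_cube d"
    using grid_point_in_unit_cube[OF assms] by (auto simp: pt_def)
  moreover have "\<exists>x\<in>pt ` nodes d \<delta> Q. \<exists>y\<in>pt ` nodes d \<delta> Q.
      coord_le d x z \<and> coord_le d z y \<and> vol d y - vol d x \<le> \<delta>" if z: "z \<in> unit_cube d" for z
  proof -
    obtain k m where c: "(k, m) \<in> cells d \<delta> Q" "coord_le d (grid_point d \<delta> Q k m) z"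
        "coord_le d z (grid_point d \<delta> Q k (upper_corner d m))"
      using cells_cover[OF assms z] by blast
    have "grid_point d \<delta> Q k m \<in> pt ` nodes d \<delta> Q" "grid_point d \<delta> Q k (upper_corner d m) \<in> pt ` nodes d \<delta> Q"
      using cell_corners_in_nodes[OF c(1)] by (force simp: pt_def)+
    then show ?thesis using c cell_vol_diff_le[OF assms c(1)] by blast
  qed
  ultimately have "is_delta_cover d \<delta> (pt ` nodes d \<delta> Q)"
    unfolding is_delta_cover_def using fin by blast
  then have "covering_number d \<delta> \<le> card (pt ` nodes d \<delta> Q)"
    unfolding covering_number_def by (intro Least_le) blast
  also have "\<dots> \<le> card (nodes d \<delta> Q)" using fin by (rule card_image_le)
  finally show ?thesis .
qed

section \<open>The number of cells and vertices\<close>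

text \<open>
  The \<open>d\<close>-th power of this number bounds the size of the whole grid, as if the grid were a product
  with that many points in each direction. The parameter \<open>a\<close> is the excess, per block and direction,
  over the number \<open>c p\<^sub>i\<close> before rounding: \<open>1\<close> for cells, and \<open>2\<close> for vertices because of the
  additional end point.
\<close>

definition edge_count :: "nat \<Rightarrow> real \<Rightarrow> nat \<Rightarrow> real \<Rightarrow> real" where
  "edge_count d \<delta> Q a
     = (1 + d / (2 * real Q) + d * (real d - 1) / (12 * real Q ^ 2) + a * real Q * \<delta>) / \<delta>"

text \<open>
  After the separation of the coordinates the sum over the blocks factors into \<open>d\<close> equal sums over
  \<open>Q\<close> intervals, to which the Faulhaber inequality for the power \<open>d - 1\<close> applies.
\<close>

lemma sum_blocks_le:
  fixes a \<delta> :: real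
  assumes "d \<ge> 2" "\<delta> > 0" "Q > 0" "a > 0"
  shows "(\<Sum>k\<in>blocks d Q. \<Prod>i<d. a + d / (\<delta> * Q) * others d Q k i)
    \<le> edge_count d \<delta> Q a ^ d"
proof -
  define c where "c = d / (\<delta> * Q)"
  have c: "c > 0" using assms by (simp add: c_def)
  obtain q where q: "d = q + 2" using assms(1) by (metis add.commute le_Suc_ex)
  have "(\<Sum>k\<in>blocks d Q. \<Prod>i<d. a + c * others d Q k i)
      \<le> (\<Sum>k\<in>blocks d Q. \<Prod>i<d. a + c * ((real (k i) + 1) / Q) ^ (d - 1))"
  proof (rule sum_mono)
    fix k :: "nat \<Rightarrow> nat"
    show "(\<Prod>i<d. a + c * others d Q k i) \<le> (\<Prod>i<d. a + c * ((real (k i) + 1) / Q) ^ (d - 1))"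
      unfolding others_def
      using prod_add_prod_others_le[of "{..<d}" a c "\<lambda>j. (real (k j) + 1) / Q"] assms c by simp
  qed
  also have "\<dots> = (\<Prod>i<d. \<Sum>j<Q. a + c * ((real j + 1) / Q) ^ (d - 1))"
    by (subst prod_sum_PiE) auto
  also have "\<dots> = (\<Sum>j<Q. a + c * ((real j + 1) / Q) ^ (d - 1)) ^ d" by simp
  also have "\<dots> \<le> edge_count d \<delta> Q a ^ d"
  proof (rule power_mono)
    have "(\<Sum>j<Q. a + c * ((real j + 1) / Q) ^ (d - 1))
        = a * Q + c / Q ^ (q + 1) * (\<Sum>j<Q. (real j + 1) ^ (q + 1))"
      by (simp add: sum.distrib q power_divide sum_distrib_left)
    also have "\<dots> \<le> a * Q + c / Q ^ (q + 1) * faulhaber q Q"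
      using c sum_power_le_faulhaber[where n = Q and q = q] by (intro add_left_mono mult_left_mono) auto
    also have "c / Q ^ (q + 1) * faulhaber q Q
        = (1 + d / (2 * real Q) + d * (real d - 1) / (12 * real Q ^ 2)) / \<delta>"
    proof -
      have "faulhaber q Q = real Q ^ (q + 2) / d + real Q ^ (q + 1) / 2 + (real q + 1) * real Q ^ q / 12"
        by (simp add: faulhaber_def q)
      moreover have "c / Q ^ (q + 1) * (real Q ^ (q + 2) / d) = 1 / \<delta>"
        using assms by (simp add: c_def field_simps)
      moreover have "c / Q ^ (q + 1) * (real Q ^ (q + 1) / 2) = d / (2 * real Q) / \<delta>"
        using assms by (simp add: c_def)
      moreover have "c / Q ^ (q + 1) * ((real q + 1) * real Q ^ q / 12)
          = d * (real d - 1) / (12 * real Q ^ 2) / \<delta>"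
        using assms by (simp add: c_def q field_simps power2_eq_square)
      ultimately show ?thesis
        by (simp only: distrib_left add_divide_distrib)
    qed
    finally show "(\<Sum>j<Q. a + c * ((real j + 1) / Q) ^ (d - 1))
        \<le> edge_count d \<delta> Q a"
      using assms by (simp add: edge_count_def add_divide_distrib)
  next
    show "0 \<le> (\<Sum>j<Q. a + c * ((real j + 1) / Q) ^ (d - 1))"
      using assms c by (intro sum_nonneg add_nonneg_nonneg) auto
  qed
  finally show ?thesis by (simp add: c_def)
qed

lemma card_cells_le:
  assumes "d \<ge> 2" "\<delta> > 0" "Q > 0"
  shows "card (cells d \<delta> Q) \<le> edge_count d \<delta> Q 1 ^ d"
proof -
  have "real (card (cells d \<delta> Q)) = (\<Sum>k\<in>blocks d Q. \<Prod>i<d. real (subdivisions d \<delta> Q k i))"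
    by (simp add: cells_def card_PiE finite_PiE)
  also have "\<dots> \<le> (\<Sum>k\<in>blocks d Q. \<Prod>i<d. 1 + d / (\<delta> * Q) * others d Q k i)"
    using subdivisions_bounds(3)[of d \<delta> Q] assms by (intro sum_mono prod_mono) auto
  also note sum_blocks_le[OF assms zero_less_one]
  finally show ?thesis .
qed

lemma card_nodes_le:
  assumes "d \<ge> 2" "\<delta> > 0" "Q > 0"
  shows "card (nodes d \<delta> Q) \<le> edge_count d \<delta> Q 2 ^ d"
proof -
  have "real (card (nodes d \<delta> Q)) = (\<Sum>k\<in>blocks d Q. \<Prod>i<d. real (subdivisions d \<delta> Q k i) + 1)"
    by (simp add: nodes_def card_PiE finite_PiE add.commute)
  also have "\<dots> \<le> (\<Sum>k\<in>blocks d Q. \<Prod>i<d. 2 + d / (\<delta> * Q) * others d Q k i)"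
  proof (intro sum_mono prod_mono conjI)
    fix k i
    show "real (subdivisions d \<delta> Q k i) + 1 \<le> 2 + d / (\<delta> * Q) * others d Q k i"
      using subdivisions_bounds(3)[of d \<delta> Q k i] assms by linarith
  qed simp
  also note sum_blocks_le[OF assms zero_less_numeral]
  finally show ?thesis .
qed

text \<open>
  With \<open>w = sqrt (2 * real d * a * \<delta>)\<close>, the terms \<open>d / (2 * Q)\<close> and \<open>a * Q * \<delta>\<close> are both equal to \<open>w / 2\<close> at
  \<open>Q = d / w\<close>, and the quadratic term is \<open>(d - 1) / 6 * (a * \<delta>)\<close> there. Rounding \<open>Q\<close> up to an integer
  costs at most \<open>a * \<delta>\<close> more, and \<open>(d - 1) / 6 + 1 = (d + 5) / 6\<close>.
\<close>

lemma ex_balanced_block_count: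
  fixes d :: nat and \<delta> a :: real
  assumes "d \<ge> 2" "\<delta> > 0" "a > 0"
  shows "\<exists>Q::nat>0. edge_count d \<delta> Q a
    \<le> (1 + sqrt (2 * real d * (a * \<delta>)) + (real d + 5) / 6 * (a * \<delta>)) / \<delta>"
proof -
  define s where "s = a * \<delta>"
  define w where "w = sqrt (2 * real d * s)"
  \<comment> \<open>The minimiser of \<open>d / (2 * r) + r * s\<close>.\<close>
  define r where "r = d / w"
  define Q where "Q = nat \<lceil>r\<rceil>"
  have s: "s > 0" using assms by (simp add: s_def)
  have w: "w > 0" "w * w = 2 * d * s" using s assms by (simp_all add: w_def)
  have r: "r > 0" using w assms by (simp add: r_def)
  have Q: "Q > 0" "r \<le> Q" "Q \<le> r + 1" using r unfolding Q_def by linarith+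
  have rs: "r * s = w / 2"
    using w by (simp add: r_def field_simps)
  have "d / (2 * real Q) \<le> d / (2 * r)"
    using Q r by (intro divide_left_mono) auto
  also have "\<dots> = w / 2" using w assms by (simp add: r_def)
  finally have 1: "d / (2 * real Q) \<le> w / 2" .
  have "d * (real d - 1) / (12 * real Q ^ 2) \<le> d * (real d - 1) / (12 * r ^ 2)"
    using Q r assms by (intro divide_left_mono mult_left_mono power_mono) auto
  also have "\<dots> = (real d - 1) * (w * w) / (12 * d)"
    using w assms by (simp add: r_def field_simps power2_eq_square)
  also have "\<dots> = (real d - 1) / 6 * s"
    using assms unfolding w(2) by (simp add: field_simps)
  finally have 2: "d * (real d - 1) / (12 * real Q ^ 2) \<le> (real d - 1) / 6 * s" .
  have "Q * s \<le> (r + 1) * s" using Q s by (intro mult_right_mono) auto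
  also have "\<dots> = w / 2 + s" using rs by (simp add: algebra_simps)
  finally have 3: "a * Q * \<delta> \<le> w / 2 + s" by (simp add: s_def mult_ac)
  have "1 + d / (2 * real Q) + d * (real d - 1) / (12 * real Q ^ 2) + a * Q * \<delta>
      \<le> 1 + w / 2 + (real d - 1) / 6 * s + (w / 2 + s)"
    using 1 2 3 by linarith
  also have "\<dots> = 1 + w + (real d + 5) / 6 * s" by (simp add: field_simps)
  finally have "edge_count d \<delta> Q a \<le> (1 + w + (real d + 5) / 6 * s) / \<delta>"
    using assms unfolding edge_count_def by (intro divide_right_mono) auto
  then show ?thesis using Q(1) unfolding w_def s_def by blast
qed

lemma bound_le_exp:
  fixes d :: nat and s :: real
  assumes "d \<ge> 1" "s \<ge> 0"
  shows "(1 + sqrt (2 * real d * s) + (real d + 5) / 6 * s) ^ d \<le> exp (d * sqrt (2 * real d * s))"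
proof -
  define w where "w = sqrt (2 * real d * s)"
  have w: "w \<ge> 0" "w\<^sup>2 / 2 = d * s" using assms by (simp_all add: w_def)
  have "(real d + 5) / 6 * s \<le> d * s" using assms by (intro mult_right_mono) auto
  then have "1 + w + (real d + 5) / 6 * s \<le> exp w"
    using exp_lower_Taylor_quadratic[OF w(1)] w(2) by linarith
  then have "(1 + w + (real d + 5) / 6 * s) ^ d \<le> exp w ^ d"
    using w assms by (intro power_mono) auto
  then show ?thesis by (simp add: w_def exp_of_nat_mult)
qed

theorem corollary4p6:
  fixes d :: nat and \<delta> :: real
  assumes "d \<ge> 2" and "0 < \<delta>" and "\<delta> < 1"
  shows
    "real (bracketing_number d \<delta>)
       \<le> real d + \<delta> powi (- int d) * (1 + sqrt (2 * real d * \<delta>) + (real d + 5) / 6 * \<delta>) ^ d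
     \<and> real d + \<delta> powi (- int d) * (1 + sqrt (2 * real d * \<delta>) + (real d + 5) / 6 * \<delta>) ^ d
       \<le> real d + \<delta> powi (- int d) * exp (real d * sqrt (2 * real d * \<delta>))
     \<and> real (covering_number d \<delta>)
       \<le> \<delta> powi (- int d) * (1 + 2 * sqrt (real d * \<delta>) + (real d + 5) / 3 * \<delta>) ^ d
     \<and> \<delta> powi (- int d) * (1 + 2 * sqrt (real d * \<delta>) + (real d + 5) / 3 * \<delta>) ^ d
       \<le> \<delta> powi (- int d) * exp (2 * real d * sqrt (real d * \<delta>))"
proof -
  have d: "d > 0" using assms by simp
  have scale: "(x / \<delta>) ^ d = \<delta> powi (- int d) * x ^ d" for x
    by (simp add: power_int_minus power_divide field_simps)
  have nonneg: "0 \<le> edge_count d \<delta> Q a" if "a > 0" for Q a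
    using assms that unfolding edge_count_def
    by (intro divide_nonneg_pos add_nonneg_nonneg mult_nonneg_nonneg divide_nonneg_nonneg) auto
  have sq: "sqrt (2 * real d * (2 * \<delta>)) = 2 * sqrt (d * \<delta>)"
    \<comment> \<open>Counting vertices instead of cells amounts to \<open>2 * \<delta>\<close> in place of \<open>\<delta>\<close> here.\<close>
    using real_sqrt_mult[of 4 "d * \<delta>"] by (simp add: mult_ac)
  have dbl: "(real d + 5) / 6 * (2 * \<delta>) = (real d + 5) / 3 * \<delta>" by simp
  obtain Q :: nat where Q: "Q > 0"
      "edge_count d \<delta> Q 1 \<le> (1 + sqrt (2 * real d * \<delta>) + (real d + 5) / 6 * \<delta>) / \<delta>"
    using ex_balanced_block_count[OF assms(1,2), of 1] by auto
  have "real (bracketing_number d \<delta>) \<le> card (cells d \<delta> Q)"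
    using bracketing_number_le_card_cells[OF d assms(2) Q(1)] by simp
  also note card_cells_le[OF assms(1,2) Q(1)]
  also note power_mono[OF Q(2) nonneg[OF zero_less_one], of d]
  finally have 1: "real (bracketing_number d \<delta>)
      \<le> \<delta> powi (- int d) * (1 + sqrt (2 * real d * \<delta>) + (real d + 5) / 6 * \<delta>) ^ d"
    unfolding scale .
  obtain R :: nat where R: "R > 0"
      "edge_count d \<delta> R 2 \<le> (1 + 2 * sqrt (real d * \<delta>) + (real d + 5) / 3 * \<delta>) / \<delta>"
    using ex_balanced_block_count[OF assms(1,2), of 2] unfolding sq dbl by auto
  have "real (covering_number d \<delta>) \<le> card (nodes d \<delta> R)"
    using covering_number_le_card_nodes[OF d assms(2) R(1)] by simp
  also note card_nodes_le[OF assms(1,2) R(1)]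
  also note power_mono[OF R(2) nonneg[OF zero_less_numeral], of d]
  finally have 2: "real (covering_number d \<delta>)
      \<le> \<delta> powi (- int d) * (1 + 2 * sqrt (real d * \<delta>) + (real d + 5) / 3 * \<delta>) ^ d"
    unfolding scale .
  have 3: "(1 + sqrt (2 * real d * \<delta>) + (real d + 5) / 6 * \<delta>) ^ d
      \<le> exp (real d * sqrt (2 * real d * \<delta>))"
    using bound_le_exp[of d \<delta>] assms by simp
  have 4: "(1 + 2 * sqrt (real d * \<delta>) + (real d + 5) / 3 * \<delta>) ^ d
      \<le> exp (2 * real d * sqrt (real d * \<delta>))"
    using bound_le_exp[of d "2 * \<delta>"] assms unfolding sq dbl by (simp add: mult_ac)
  show ?thesis
    using 1 2 3 4 assms by (auto intro!: mult_left_mono)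
qed

end
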